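(* Let $\gamma\in(0,1]$, $\lambda>0$, and let $X$ be an $\mathrm{SDS}(\gamma,\lambda)$ random variable. Then $$\mathbb{P}(X=k)=\sum_{i=|k|}^{\infty}\sum_{j=0}^{\infty}(-1)^{i+j}\binom{\gamma j}{i}\frac{\lambda^j}{j!}\frac{1}{2^i}\binom{i}{\frac{i+k}{2}},\qquad k\in\mathbb{Z}.$$ In the case $\gamma=1$ this simplifies to $$\mathbb{P}(X=k)=e^{-\lambda}I_k(\lambda),\qquad k\in\mathbb{Z},$$ where $I_k$ is the modified Bessel function of the first kind.
   Context: For $\gamma\in(0,1]$ and $\lambda>0$, $\mathrm{SDS}(\gamma,\lambda)$ denotes the distribution on $\mathbb{Z}$ with probability generating function, for $|z|=1$, $$\sum_{k\in\mathbb{Z}}\mathbb{P}(X=k)z^k=\exp\left\{-\lambda\left(1-\frac12\left(z+\frac1z\right)\right)^{\gamma}\right\}.$$ Here $\binom{x}{i}=x(x-1)\cdots(x-i+1)/i!$ for real $x$, and $\binom{i}{(i+k)/2}$ is taken to be $0$ when $i+k$ is odd. The double sum is an iterated sum: first over $j$, then over $i$. *)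

theory Defs
  imports "HOL-Probability.Probability"
begin

text \<open>For \<open>norm z = 1\<close> the base \<open>1 - (z + 1 / z) / 2 = 1 - Re z\<close> is a nonnegative real, on which
  the principal power \<open>powr\<close> is the real power; \<open>0 powr \<gamma> = 0\<close> agrees with it since \<open>\<gamma> > 0\<close>.\<close>

definition SDS_pgf :: "real \<Rightarrow> real \<Rightarrow> complex \<Rightarrow> complex" where
  "SDS_pgf \<gamma> l z = exp (- of_real l * (1 - (1 / 2) * (z + 1 / z)) powr of_real \<gamma>)"

definition is_SDS :: "real \<Rightarrow> real \<Rightarrow> int measure \<Rightarrow> bool" where
  "is_SDS \<gamma> l D \<longleftrightarrow>
     prob_space D \<and> sets D = UNIV \<and>
     (\<forall>z::complex. norm z = 1 \<longrightarrow>
        ((\<lambda>k::int. of_real (measure D {k}) * z powi k) has_sum SDS_pgf \<gamma> l z) UNIV)"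

text \<open>The binomial coefficient of \<open>i\<close> over \<open>(i + k) / 2\<close>, which is 0 when \<open>i + k\<close> is odd. It is only
  meant for \<open>i \<ge> \<bar>k\<bar>\<close>, where \<open>nat\<close> does not truncate.\<close>

definition half_binomial :: "nat \<Rightarrow> int \<Rightarrow> real" where
  "half_binomial i k =
     (if even (int i + k) then of_nat (i choose nat ((int i + k) div 2)) else 0)"

text \<open>Modified Bessel function of the first kind, of integer order. Since \<open>rGamma\<close> is the entire
  function \<open>1 / Gamma\<close>, which vanishes at the nonpositive integers, the usual power series also
  covers negative orders.\<close>

definition bessel_I :: "int \<Rightarrow> real \<Rightarrow> real" where
  "bessel_I k x =
     (\<Sum>m. rGamma (of_nat m + of_int k + 1) / fact m * (x / 2) powi (2 * int m + k))"

end

theory Submission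
  imports Defs
begin

text \<open>On the unit circle \<open>z = cis t\<close> the generating function is \<open>f (cos t)\<close> with
  \<open>f w = exp (- l * (1 - w) powr \<gamma>)\<close>. Expanding first the exponential and then each power
  \<open>(1 - w) powr (\<gamma> * j)\<close> by the binomial series gives, for \<open>\<bar>w\<bar> < 1\<close>, a double series that
  converges absolutely, so that \<open>f w = (\<Sum>i. a\<^sub>i * w ^ i)\<close>, where \<open>a\<^sub>i\<close> is the inner sum over \<open>j\<close> of
  the formula to be proved (\<open>sds_power_series\<close>). The \<open>k\<close>-th Fourier coefficient of \<open>cos t ^ i\<close> is
  \<open>half_binomial i k / 2 ^ i\<close> for \<open>i \<ge> \<bar>k\<bar>\<close> and 0 for smaller \<open>i\<close>, so comparing the \<open>k\<close>-th
  Fourier coefficients of both expansions of \<open>f (cos t)\<close> yields the claim.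

  The point that needs an argument is that the power series may be used on the whole circle,
  where \<open>w = cos t\<close> reaches \<open>\<plusminus>1\<close> and termwise integration needs a uniform bound. Both follow from
  \<open>\<Sum>\<bar>a\<^sub>i\<bar> < \<infinity>\<close>. This holds because \<open>a\<^sub>i \<ge> 0\<close> (\<open>sds_coeff_nonneg\<close>): then the partial sums are
  bounded by the supremum of \<open>f\<close> on \<open>[0, 1)\<close>, which is at most 1 (\<open>sds_coeff_summable\<close>). Nonnegativity
  reflects that \<open>1 - (1 - w) powr \<gamma>\<close> has nonnegative Taylor coefficients for \<open>\<gamma> \<le> 1\<close>, and that \<open>f\<close>
  is \<open>exp (- l)\<close> times the exponential of \<open>l\<close> times that function.

  For \<open>\<gamma> = 1\<close> the same comparison of Fourier coefficients applies to the Taylor series of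
  \<open>exp (- l) * exp (l * cos t)\<close>, and substituting \<open>i = 2 * m + k\<close> turns the result into the Bessel
  series.\<close>

section \<open>Power series of the generating function in the open unit disc\<close>

definition sds_term :: "real \<Rightarrow> real \<Rightarrow> nat \<Rightarrow> nat \<Rightarrow> real" where
  "sds_term \<gamma> l i j = (-1) ^ (i + j) * ((\<gamma> * real j) gchoose i) * (l ^ j / fact j)"

definition sds_coeff :: "real \<Rightarrow> real \<Rightarrow> nat \<Rightarrow> real" where
  "sds_coeff \<gamma> l i = (\<Sum>j. sds_term \<gamma> l i j)"

lemma gbinomial_neg_upper:
  fixes x :: real
  shows "(-1) ^ i * ((-x) gchoose i) = pochhammer x i / fact i"
  by (simp add: gbinomial_pochhammer flip: power_mult_distrib)

text \<open>Replacing the upper index \<open>x\<close> by \<open>- x\<close> makes all factors of the same sign, which gives a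
  majorant whose generating function is again a power.\<close>

lemma abs_gbinomial_le_pochhammer:
  fixes x :: real
  assumes "0 \<le> x"
  shows "\<bar>x gchoose i\<bar> \<le> pochhammer x i / fact i"
proof -
  have "\<bar>pochhammer (-x) i\<bar> \<le> pochhammer x i"
    unfolding pochhammer_prod abs_prod using assms by (intro prod_mono) auto
  thus ?thesis
    by (simp add: gbinomial_pochhammer abs_mult power_abs divide_right_mono)
qed

lemma pochhammer_series:
  fixes x w :: real
  assumes "0 \<le> x" "0 \<le> w" "w < 1"
  shows "((\<lambda>i. pochhammer x i / fact i * w ^ i) has_sum (1 - w) powr (-x)) UNIV"
proof (rule sums_nonneg_imp_has_sum)
  have "(\<lambda>n. ((-x) gchoose n) * (-w) ^ n) sums (1 + (-w)) powr (-x)"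
    by (rule gen_binomial_real) (use assms in auto)
  also have "(\<lambda>n. ((-x) gchoose n) * (-w) ^ n) = (\<lambda>i. pochhammer x i / fact i * w ^ i)"
    by (simp add: gbinomial_neg_upper[symmetric] power_minus[of w] mult_ac)
  finally show "(\<lambda>i. pochhammer x i / fact i * w ^ i) sums (1 - w) powr (-x)" by simp
next
  fix i show "0 \<le> pochhammer x i / fact i * w ^ i"
    using assms by (auto intro!: mult_nonneg_nonneg divide_nonneg_nonneg prod_nonneg
        simp: pochhammer_prod)
qed

text \<open>The majorant of each row sums to \<open>(l * (1 - \<bar>w\<bar>) powr (- \<gamma>)) ^ j / fact j\<close>, and these row sums
  form an exponential series.\<close>

lemma sds_term_abs_summable:
  assumes "0 \<le> \<gamma>" "0 \<le> l" "\<bar>w\<bar> < 1"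
  shows "(\<lambda>x. norm (case x of (j, i) \<Rightarrow> sds_term \<gamma> l i j * w ^ i)) summable_on UNIV \<times> UNIV"
proof -
  define g where "g = (\<lambda>(j, i). l ^ j / fact j * (pochhammer (\<gamma> * real j) i / fact i * \<bar>w\<bar> ^ i))"
  have inner: "((\<lambda>i. g (j, i)) has_sum ((l * (1 - \<bar>w\<bar>) powr (- \<gamma>)) ^ j / fact j)) UNIV" for j
  proof -
    have "((\<lambda>i. g (j, i)) has_sum (l ^ j / fact j * (1 - \<bar>w\<bar>) powr (- (\<gamma> * real j)))) UNIV"
      unfolding g_def prod.case
      by (intro has_sum_cmult_right pochhammer_series) (use assms in auto)
    also have "(1 - \<bar>w\<bar>) powr (- (\<gamma> * real j)) = ((1 - \<bar>w\<bar>) powr (- \<gamma>)) ^ j"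
      using assms(3) by (simp flip: powr_realpow add: powr_powr)
    finally show ?thesis by (simp add: power_mult_distrib)
  qed
  have "(\<lambda>j. (l * (1 - \<bar>w\<bar>) powr (- \<gamma>)) ^ j / fact j) summable_on UNIV"
    using assms summable_exp[of "l * (1 - \<bar>w\<bar>) powr (- \<gamma>)"]
    by (intro summable_nonneg_imp_summable_on) (auto simp: field_simps)
  hence "g summable_on UNIV \<times> UNIV"
    using inner
    by (rule_tac summable_on_SigmaI)
       (use assms in \<open>auto simp: g_def pochhammer_prod
          intro!: mult_nonneg_nonneg divide_nonneg_nonneg prod_nonneg\<close>)
  thus ?thesis
  proof (rule Infinite_Sum.abs_summable_on_comparison_test')
    fix x :: "nat \<times> nat"
    obtain j i where x: "x = (j, i)" by force
    have "\<bar>(\<gamma> * real j) gchoose i\<bar> * ((l ^ j / fact j) * \<bar>w\<bar> ^ i)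
        \<le> pochhammer (\<gamma> * real j) i / fact i * ((l ^ j / fact j) * \<bar>w\<bar> ^ i)"
      by (intro mult_right_mono abs_gbinomial_le_pochhammer) (use assms in auto)
    thus "norm (case x of (j, i) \<Rightarrow> sds_term \<gamma> l i j * w ^ i) \<le> g x"
      using assms by (simp add: x g_def sds_term_def abs_mult power_abs mult_ac)
  qed
qed

text \<open>A column of the double series at any fixed \<open>w \<noteq> 0\<close>, with the factor \<open>w ^ i\<close> removed.\<close>

lemma sds_term_summable:
  assumes "0 \<le> \<gamma>" "0 \<le> l"
  shows "sds_term \<gamma> l i summable_on UNIV"
proof -
  have "(\<lambda>(j, i). sds_term \<gamma> l i j * (1/2) ^ i) summable_on UNIV \<times> UNIV"
    by (rule abs_summable_summable, rule sds_term_abs_summable) (use assms in auto)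
  hence "(\<lambda>(i, j). sds_term \<gamma> l i j * (1/2) ^ i) summable_on UNIV \<times> UNIV"
    by (subst summable_on_swap) (simp add: case_prod_unfold)
  from summable_on_SigmaD1[OF this, of i]
  have "(\<lambda>j. sds_term \<gamma> l i j * (1/2) ^ i) summable_on UNIV" by simp
  from summable_on_cmult_left[OF this, of "2 ^ i"] show ?thesis
    by (simp add: power_one_over field_simps)
qed

lemma sds_coeff_has_sum:
  assumes "0 \<le> \<gamma>" "0 \<le> l"
  shows "(sds_term \<gamma> l i has_sum sds_coeff \<gamma> l i) UNIV"
proof -
  have "(sds_term \<gamma> l i has_sum infsum (sds_term \<gamma> l i) UNIV) UNIV"
    by (rule has_sum_infsum, rule sds_term_summable[OF assms])
  thus ?thesis
    using has_sum_imp_sums sums_unique unfolding sds_coeff_def by metis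
qed

text \<open>Summing rows first gives the exponential series of \<open>- l * (1 - w) powr \<gamma>\<close>; summing columns first
  gives the power series.\<close>

lemma sds_power_series:
  assumes "0 \<le> \<gamma>" "0 \<le> l" "\<bar>w\<bar> < 1"
  shows "((\<lambda>i. sds_coeff \<gamma> l i * w ^ i) has_sum exp (- l * (1 - w) powr \<gamma>)) UNIV"
proof -
  have inner: "((\<lambda>i. sds_term \<gamma> l i j * w ^ i)
      has_sum ((- l * (1 - w) powr \<gamma>) ^ j / fact j)) UNIV" for j
  proof -
    have "(\<lambda>i. sds_term \<gamma> l i j * w ^ i) summable_on UNIV"
      using summable_on_SigmaD1[OF abs_summable_summable[OF sds_term_abs_summable[OF assms]], of j]
      by simp
    then obtain S where S: "((\<lambda>i. sds_term \<gamma> l i j * w ^ i) has_sum S) UNIV"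
      by (auto simp: summable_on_def)
    have "(\<lambda>i. ((-l) ^ j / fact j) * (((\<gamma> * real j) gchoose i) * (-w) ^ i))
        sums (((-l) ^ j / fact j) * (1 + (-w)) powr (\<gamma> * real j))"
      by (intro sums_mult gen_binomial_real) (use assms in auto)
    also have "(\<lambda>i. ((-l) ^ j / fact j) * (((\<gamma> * real j) gchoose i) * (-w) ^ i))
        = (\<lambda>i. sds_term \<gamma> l i j * w ^ i)"
      by (simp add: sds_term_def power_minus[of w] power_minus[of l] power_add mult_ac)
    also have "(1 + (-w)) powr (\<gamma> * real j) = ((1 - w) powr \<gamma>) ^ j"
      using assms(3) by (simp flip: powr_realpow add: powr_powr)
    also have "(-l) ^ j / fact j * ((1 - w) powr \<gamma>) ^ j = (- l * (1 - w) powr \<gamma>) ^ j / fact j"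
      by (simp only: power_mult_distrib times_divide_eq_left)
    finally show ?thesis
      using S has_sum_imp_sums[OF S] sums_unique2 by blast
  qed
  have outer: "((\<lambda>j. (- l * (1 - w) powr \<gamma>) ^ j / fact j) has_sum exp (- l * (1 - w) powr \<gamma>)) UNIV"
    using exp_converges[of "- l * (1 - w) powr \<gamma>"] summable_norm_exp[of "- l * (1 - w) powr \<gamma>"]
    by (intro norm_summable_imp_has_sum) (auto simp: divide_inverse_commute)
  have "((\<lambda>(j, i). sds_term \<gamma> l i j * w ^ i) has_sum exp (- l * (1 - w) powr \<gamma>)) (UNIV \<times> UNIV)"
    by (rule has_sum_SigmaI[OF _ outer abs_summable_summable[OF sds_term_abs_summable[OF assms]]])
       (use inner in simp)
  hence "((\<lambda>(i, j). sds_term \<gamma> l i j * w ^ i) has_sum exp (- l * (1 - w) powr \<gamma>)) (UNIV \<times> UNIV)"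
    by (subst has_sum_swap) (simp add: case_prod_unfold)
  thus ?thesis
    by (rule has_sum_SigmaD) (use sds_coeff_has_sum[OF assms(1,2)] in \<open>auto intro: has_sum_cmult_left\<close>)
qed

section \<open>Nonnegativity and summability of the coefficients\<close>

text \<open>With \<open>f w = exp (- l * (1 - w) powr \<gamma>)\<close> this is the coefficient form, for each \<open>j\<close>, of the
  differential equation \<open>f' w = l * \<gamma> * (1 - w) powr (\<gamma> - 1) * f w\<close>. The factor \<open>Suc i\<close> is absorbed
  into the binomial coefficient, and Vandermonde's identity splits the upper index
  \<open>\<gamma> * Suc j - 1\<close> as \<open>(\<gamma> - 1) + \<gamma> * j\<close>. The coefficients \<open>pochhammer (1 - \<gamma>) m / fact m\<close> are those
  of \<open>(1 - w) powr (\<gamma> - 1)\<close>.\<close>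

lemma sds_term_Suc:
  "real (Suc i) * sds_term \<gamma> l (Suc i) (Suc j)
     = l * (\<Sum>m\<le>i. \<gamma> * (pochhammer (1 - \<gamma>) m / fact m) * sds_term \<gamma> l (i - m) j)"
proof -
  have "real (Suc i) * ((\<gamma> * real (Suc j)) gchoose Suc i)
      = \<gamma> * real (Suc j) * (((\<gamma> - 1) + \<gamma> * real j) gchoose i)"
    by (subst gbinomial_absorption) (simp add: algebra_simps)
  also have "((\<gamma> - 1) + \<gamma> * real j) gchoose i
      = (\<Sum>m\<le>i. ((\<gamma> - 1) gchoose m) * ((\<gamma> * real j) gchoose (i - m)))"
    by (subst gbinomial_Vandermonde[symmetric]) (simp add: atMost_atLeast0)
  finally have "real (Suc i) * ((\<gamma> * real (Suc j)) gchoose Suc i) =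
     \<gamma> * real (Suc j) * (\<Sum>m\<le>i. ((\<gamma> - 1) gchoose m) * ((\<gamma> * real j) gchoose (i - m)))" .
  hence "real (Suc i) * sds_term \<gamma> l (Suc i) (Suc j)
      = (-1) ^ (i + j) * (l ^ Suc j / fact (Suc j)) * (\<gamma> * real (Suc j) *
          (\<Sum>m\<le>i. ((\<gamma> - 1) gchoose m) * ((\<gamma> * real j) gchoose (i - m))))"
    by (simp add: sds_term_def del: of_nat_Suc fact_Suc)
  also have "\<dots> = l * (l ^ j / fact j) * (-1) ^ (i + j) * \<gamma> *
          (\<Sum>m\<le>i. ((\<gamma> - 1) gchoose m) * ((\<gamma> * real j) gchoose (i - m)))"
    by (simp add: field_simps del: of_nat_Suc)
  also have "\<dots> = l * (\<Sum>m\<le>i. \<gamma> * (pochhammer (1 - \<gamma>) m / fact m) * sds_term \<gamma> l (i - m) j)"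
    unfolding sum_distrib_left
  proof (rule sum.cong[OF refl])
    fix m assume m: "m \<in> {..i}"
    have "(-1) ^ (i + j) = (-1::real) ^ m * (-1) ^ (i - m + j)"
      using m by (simp flip: power_add)
    moreover have "(-1::real) ^ m * ((\<gamma> - 1) gchoose m) = pochhammer (1 - \<gamma>) m / fact m"
      using gbinomial_neg_upper[of m "1 - \<gamma>"] by simp
    ultimately show "l * (l ^ j / fact j) * (-1) ^ (i + j) * \<gamma> *
         (((\<gamma> - 1) gchoose m) * ((\<gamma> * real j) gchoose (i - m)))
       = l * (\<gamma> * (pochhammer (1 - \<gamma>) m / fact m) * sds_term \<gamma> l (i - m) j)"
      by (simp add: sds_term_def mult_ac flip: \<open>_ = pochhammer (1 - \<gamma>) m / fact m\<close>)
  qed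
  finally show ?thesis .
qed

lemma sds_coeff_Suc:
  assumes "0 \<le> \<gamma>" "0 \<le> l"
  shows "real (Suc i) * sds_coeff \<gamma> l (Suc i)
     = l * (\<Sum>m\<le>i. \<gamma> * (pochhammer (1 - \<gamma>) m / fact m) * sds_coeff \<gamma> l (i - m))"
proof -
  have sums: "sds_term \<gamma> l i sums sds_coeff \<gamma> l i" for i
    using sds_coeff_has_sum[OF assms] by (rule has_sum_imp_sums)
  have "(\<lambda>j. real (Suc i) * sds_term \<gamma> l (Suc i) (Suc j))
      sums (l * (\<Sum>m\<le>i. \<gamma> * (pochhammer (1 - \<gamma>) m / fact m) * sds_coeff \<gamma> l (i - m)))"
    unfolding sds_term_Suc by (intro sums_mult sums_sum sums)
  moreover have "(\<lambda>j. real (Suc i) * sds_term \<gamma> l (Suc i) (Suc j)) sums (real (Suc i) * sds_coeff \<gamma> l (Suc i))"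
  proof (rule sums_mult)
    have "sds_term \<gamma> l (Suc i) 0 = 0" by (simp add: sds_term_def)
    thus "(\<lambda>j. sds_term \<gamma> l (Suc i) (Suc j)) sums sds_coeff \<gamma> l (Suc i)"
      using sums[of "Suc i"] by (subst sums_Suc_iff) simp
  qed
  ultimately show ?thesis by (rule sums_unique2[symmetric])
qed

text \<open>The recurrence \<open>sds_coeff_Suc\<close> has nonnegative weights, since \<open>1 - \<gamma> \<ge> 0\<close>, and it starts from
  \<open>sds_coeff \<gamma> l 0 = exp (- l)\<close>.\<close>

lemma sds_coeff_nonneg:
  assumes "0 \<le> \<gamma>" "\<gamma> \<le> 1" "0 \<le> l"
  shows "0 \<le> sds_coeff \<gamma> l i"
proof (induction i rule: less_induct)
  case (less i)
  show ?case
  proof (cases i)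
    case 0
    have "sds_term \<gamma> l 0 = (\<lambda>j. (-l) ^ j / fact j)"
      by (auto simp: sds_term_def power_minus[of l])
    hence "sds_term \<gamma> l 0 sums exp (- l)"
      using exp_converges[of "-l"] by (simp add: divide_inverse_commute)
    thus ?thesis unfolding 0 sds_coeff_def by (simp add: sums_iff)
  next
    case (Suc n)
    have "0 \<le> real (Suc n) * sds_coeff \<gamma> l (Suc n)"
      unfolding sds_coeff_Suc[OF assms(1,3)]
      by (intro mult_nonneg_nonneg sum_nonneg divide_nonneg_nonneg)
         (use assms less.IH Suc in \<open>auto simp: pochhammer_prod intro!: prod_nonneg\<close>)
    thus ?thesis unfolding Suc by (simp add: zero_le_mult_iff del: of_nat_Suc)
  qed
qed

text \<open>A finite partial sum at \<open>w < 1\<close> is at most \<open>exp (- l * (1 - w) powr \<gamma>) \<le> 1\<close> because the other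
  terms are nonnegative; let \<open>w\<close> tend to 1.\<close>

lemma sds_coeff_summable:
  assumes "0 \<le> \<gamma>" "\<gamma> \<le> 1" "0 \<le> l"
  shows "sds_coeff \<gamma> l summable_on UNIV"
proof (rule nonneg_bdd_above_summable_on)
  show "bdd_above (sum (sds_coeff \<gamma> l) ` {F. F \<subseteq> UNIV \<and> finite F})"
  proof (rule bdd_aboveI2)
    fix F :: "nat set" assume "F \<in> {F. F \<subseteq> UNIV \<and> finite F}"
    hence F: "finite F" by simp
    have le: "(\<Sum>i\<in>F. sds_coeff \<gamma> l i * w ^ i) \<le> 1" if w: "0 \<le> w" "w < 1" for w :: real
    proof -
      have "(\<Sum>i\<in>F. sds_coeff \<gamma> l i * w ^ i) \<le> exp (- l * (1 - w) powr \<gamma>)"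
        by (rule has_sum_mono_neutral[OF has_sum_finite[OF F] sds_power_series])
           (use assms w sds_coeff_nonneg in auto)
      also have "\<dots> \<le> 1" using assms by (simp add: mult_nonneg_nonneg)
      finally show ?thesis .
    qed
    have "((\<lambda>w. \<Sum>i\<in>F. sds_coeff \<gamma> l i * w ^ i) \<longlongrightarrow> (\<Sum>i\<in>F. sds_coeff \<gamma> l i * 1 ^ i)) (at_left 1)"
      by (intro tendsto_intros)
    moreover have "eventually (\<lambda>w::real. (\<Sum>i\<in>F. sds_coeff \<gamma> l i * w ^ i) \<le> 1) (at_left 1)"
      using le by (intro eventually_at_leftI[of 0]) auto
    ultimately have "(\<Sum>i\<in>F. sds_coeff \<gamma> l i * 1 ^ i) \<le> 1"
      by (rule tendsto_upperbound) simp
    thus "sum (sds_coeff \<gamma> l) F \<le> 1" by simp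
  qed
qed (rule sds_coeff_nonneg[OF assms])

text \<open>Absolute summability of the coefficients makes the series a continuous function on \<open>[-1, 1]\<close>.
  The exponential is continuous there too, the point 1 being where \<open>\<gamma> > 0\<close> matters, and the two agree
  in the interior.\<close>

lemma sds_power_series_closed:
  assumes "0 < \<gamma>" "\<gamma> \<le> 1" "0 \<le> l" "\<bar>w\<bar> \<le> 1"
  shows "((\<lambda>i. sds_coeff \<gamma> l i * w ^ i) has_sum exp (- l * (1 - w) powr \<gamma>)) UNIV"
proof -
  define s where "s w = (\<Sum>\<^sub>\<infinity>i. sds_coeff \<gamma> l i * w ^ i)" for w
  have nonneg: "0 \<le> sds_coeff \<gamma> l i" for i using assms by (intro sds_coeff_nonneg) auto
  have summ: "sds_coeff \<gamma> l summable_on UNIV" using assms by (intro sds_coeff_summable) auto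
  have bound: "norm (sds_coeff \<gamma> l i * w ^ i) \<le> sds_coeff \<gamma> l i" if "w \<in> {-1..1}" for i w
  proof -
    have "\<bar>w\<bar> ^ i \<le> 1" using that by (intro power_le_one) auto
    with nonneg[of i] show ?thesis by (simp add: abs_mult power_abs mult_left_le)
  qed
  have s: "((\<lambda>i. sds_coeff \<gamma> l i * w ^ i) has_sum s w) UNIV" if "w \<in> {-1..1}" for w
    unfolding s_def using Infinite_Sum.abs_summable_on_comparison_test'[OF summ bound[OF that]]
    by (rule has_sum_infsum[OF abs_summable_summable])
  have "uniform_limit {-1..1} (\<lambda>F w. \<Sum>i\<in>F. sds_coeff \<gamma> l i * w ^ i) s (finite_subsets_at_top UNIV)"
    by (rule Weierstrass_m_test_general'[OF bound s summ])
  hence "continuous_on {-1..1} s"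
    by (rule uniform_limit_theorem[rotated]) (simp_all add: always_eventually continuous_intros)
  moreover have "continuous_on {-1..1} (\<lambda>w. exp (- l * (1 - w) powr \<gamma>))"
    using assms by (intro continuous_intros continuous_on_powr') auto
  ultimately have "continuous_on (closure {-1<..<1}) (\<lambda>w. s w - exp (- l * (1 - w) powr \<gamma>))"
    by (simp add: closure_greaterThanLessThan continuous_on_diff)
  moreover have "s w - exp (- l * (1 - w) powr \<gamma>) = 0" if "w \<in> {-1<..<1}" for w
    using has_sum_unique[OF s sds_power_series[of \<gamma> l w]] that assms by auto
  ultimately have "s w - exp (- l * (1 - w) powr \<gamma>) = 0"
    by (rule continuous_constant_on_closure) (use assms in \<open>auto simp: closure_greaterThanLessThan\<close>)
  moreover have "((\<lambda>i. sds_coeff \<gamma> l i * w ^ i) has_sum s w) UNIV"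
    using assms by (intro s) auto
  ultimately show ?thesis by simp
qed

section \<open>Fourier coefficients of series in powers of the cosine\<close>

lemma termwise_integral:
  fixes b :: "'i \<Rightarrow> complex" and u :: "'i \<Rightarrow> real \<Rightarrow> complex" and I :: "'i \<Rightarrow> complex"
  assumes b: "(\<lambda>x. norm (b x)) summable_on UNIV"
    and u: "\<And>x. continuous_on {c..d} (u x)" "\<And>x t. t \<in> {c..d} \<Longrightarrow> norm (u x t) \<le> 1"
    and I: "\<And>x. (u x has_integral I x) {c..d}"
    and G: "\<And>t. t \<in> {c..d} \<Longrightarrow> ((\<lambda>x. b x * u x t) has_sum G t) UNIV"
  shows "((\<lambda>x. b x * I x) has_sum integral {c..d} G) UNIV"
proof -
  have "uniform_limit {c..d} (\<lambda>F t. \<Sum>x\<in>F. b x * u x t) G (finite_subsets_at_top UNIV)"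
  proof (rule Weierstrass_m_test_general'[OF _ G b])
    fix x t assume "t \<in> {c..d}"
    from u(2)[OF this, of x] show "norm (b x * u x t) \<le> norm (b x)"
      by (simp add: norm_mult mult_left_le)
  qed
  then obtain K J where K: "\<And>F. ((\<lambda>t. \<Sum>x\<in>F. b x * u x t) has_integral K F) {c..d}"
    and J: "(G has_integral J) {c..d}" and KJ: "(K \<longlongrightarrow> J) (finite_subsets_at_top UNIV)"
    by (rule uniform_limit_integral) (auto intro!: continuous_intros u)
  have "eventually (\<lambda>F. K F = (\<Sum>x\<in>F. b x * I x)) (finite_subsets_at_top UNIV)"
  proof (rule eventually_finite_subsets_at_top_weakI)
    fix F :: "'i set" assume "finite F"
    hence "((\<lambda>t. \<Sum>x\<in>F. b x * u x t) has_integral (\<Sum>x\<in>F. b x * I x)) {c..d}"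
      by (intro has_integral_sum has_integral_mult_right I)
    thus "K F = (\<Sum>x\<in>F. b x * I x)" using K has_integral_unique by blast
  qed
  with KJ have "((\<lambda>F. \<Sum>x\<in>F. b x * I x) \<longlongrightarrow> J) (finite_subsets_at_top UNIV)"
    by (rule Lim_transform_eventually)
  thus ?thesis using J by (simp add: has_sum_def integral_unique)
qed

lemma has_integral_cis_period:
  fixes m :: int
  shows "((\<lambda>t. cis (of_int m * t)) has_integral complex_of_real (if m = 0 then 2 * pi else 0)) {0..2*pi}"
proof (cases "m = 0")
  case True
  thus ?thesis using has_integral_const_real[of "1::complex" 0 "2*pi"] by (simp add: scaleR_conv_of_real)
next
  case False
  have "((\<lambda>t. cis (of_int m * t)) has_integral
      (cis (of_int m * (2*pi)) / (\<i> * of_int m) - cis (of_int m * 0) / (\<i> * of_int m))) {0..2*pi}"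
  proof (rule fundamental_theorem_of_calculus)
    fix t :: real
    show "((\<lambda>t. cis (of_int m * t) / (\<i> * of_int m)) has_vector_derivative cis (of_int m * t))
        (at t within {0..2*pi})"
    proof -
      have "((\<lambda>z. exp (\<i> * of_int m * z) / (\<i> * of_int m)) has_field_derivative
          exp (\<i> * of_int m * of_real t)) (at (of_real t))"
        using False by (auto intro!: derivative_eq_intros)
      from has_vector_derivative_real_field[OF this] show ?thesis
        by (simp add: cis_conv_exp mult.assoc)
    qed
  qed auto
  moreover have "cis (of_int m * (2*pi)) = 1"
    using cis_multiple_2pi[of "of_int m"] by (simp add: mult_ac)
  ultimately show ?thesis using False by simp
qed

text \<open>The \<open>k\<close>-th Fourier coefficient of \<open>cos t ^ i\<close>. The case distinction is needed because
  \<open>half_binomial i k\<close> can be 1 for \<open>k < - i\<close>, through truncation by \<open>nat\<close>.\<close>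

definition cos_power_fourier :: "nat \<Rightarrow> int \<Rightarrow> real" where
  "cos_power_fourier i k = (if nat \<bar>k\<bar> \<le> i then half_binomial i k / 2 ^ i else 0)"

lemma cos_power_cis:
  "of_real (cos t ^ i) * cis (- of_int k * t)
    = (\<Sum>m\<le>i. of_real (real (i choose m) / 2 ^ i) * cis (of_int (2 * int m - int i - k) * t))"
proof -
  have "complex_of_real (cos t) = (cis t + cis (- t)) / 2"
    by (simp add: complex_eq_iff)
  hence "of_real (cos t ^ i) = (cis t + cis (- t)) ^ i / (2::complex) ^ i"
    by (simp only: of_real_power power_divide)
  also have "(cis t + cis (- t)) ^ i = (\<Sum>m\<le>i. of_nat (i choose m) * cis t ^ m * cis (- t) ^ (i - m))"
    by (rule binomial_ring)
  finally have "of_real (cos t ^ i) * cis (- of_int k * t) =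
     (\<Sum>m\<le>i. of_real (real (i choose m) / 2 ^ i) * (cis t ^ m * cis (- t) ^ (i - m) * cis (- of_int k * t)))"
    by (simp only:) (simp add: sum_distrib_left sum_distrib_right sum_divide_distrib mult_ac)
  also have "\<dots> = (\<Sum>m\<le>i. of_real (real (i choose m) / 2 ^ i) * cis (of_int (2 * int m - int i - k) * t))"
  proof (intro sum.cong refl arg_cong2[where f = "(*)"])
    fix m assume "m \<in> {..i}"
    hence "real m * t + real (i - m) * (- t) + - of_int k * t = of_int (2 * int m - int i - k) * t"
      by (simp add: of_nat_diff algebra_simps)
    thus "cis t ^ m * cis (- t) ^ (i - m) * cis (- of_int k * t) = cis (of_int (2 * int m - int i - k) * t)"
      by (simp only: Complex.DeMoivre cis_mult)
  qed
  finally show ?thesis .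
qed

lemma has_integral_cos_power:
  "((\<lambda>t. of_real (cos t ^ i) * cis (- of_int k * t))
     has_integral of_real (2 * pi * cos_power_fourier i k)) {0..2*pi}"
proof -
  have "((\<lambda>t. of_real (cos t ^ i) * cis (- of_int k * t)) has_integral
      (\<Sum>m\<le>i. complex_of_real (real (i choose m) / 2 ^ i) *
         complex_of_real (if 2 * int m - int i - k = 0 then 2 * pi else 0))) {0..2*pi}"
    unfolding cos_power_cis
    by (intro has_integral_sum has_integral_mult_right has_integral_cis_period finite_atMost)
  also have "(\<Sum>m\<le>i. complex_of_real (real (i choose m) / 2 ^ i) *
         complex_of_real (if 2 * int m - int i - k = 0 then 2 * pi else 0))
       = of_real (\<Sum>m\<le>i. if 2 * int m = int i + k then 2 * pi * (real (i choose m) / 2 ^ i) else 0)"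
    unfolding of_real_sum by (intro sum.cong) auto
  also have "(\<Sum>m\<le>i. if 2 * int m = int i + k then 2 * pi * (real (i choose m) / 2 ^ i) else 0)
      = 2 * pi * cos_power_fourier i k"
  proof (cases "even (int i + k) \<and> nat \<bar>k\<bar> \<le> i")
    case True
    define n where "n = nat ((int i + k) div 2)"
    have n: "2 * int n = int i + k" using True unfolding n_def by (auto elim!: evenE)
    have "n \<le> i" using True n by linarith
    have "(\<Sum>m\<le>i. if 2 * int m = int i + k then 2 * pi * (real (i choose m) / 2 ^ i) else 0)
        = (\<Sum>m\<le>i. if m = n then 2 * pi * (real (i choose m) / 2 ^ i) else 0)"
      by (intro sum.cong refl) (use n in auto)
    also have "\<dots> = 2 * pi * (real (i choose n) / 2 ^ i)" using \<open>n \<le> i\<close> by simp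
    finally show ?thesis using True by (simp add: cos_power_fourier_def half_binomial_def n_def)
  next
    case False
    have "2 * int m \<noteq> int i + k" if "m \<le> i" for m
    proof
      assume eq: "2 * int m = int i + k"
      hence "even (int i + k)" by (metis dvd_triv_left)
      moreover have "nat \<bar>k\<bar> \<le> i" using eq that by linarith
      ultimately show False using False by simp
    qed
    moreover have "cos_power_fourier i k = 0"
      using False by (auto simp: cos_power_fourier_def half_binomial_def)
    ultimately show ?thesis by (auto intro!: sum.neutral)
  qed
  finally show ?thesis .
qed

text \<open>Both sides are \<open>1 / (2 * pi)\<close> times the integral of \<open>G t * cis (- k * t)\<close> over a period,
  evaluated termwise: the exponentials \<open>cis (m * t)\<close> are orthogonal, and the powers of the cosine
  contribute their Fourier coefficients.\<close>

lemma fourier_coeff_cos_series: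
  fixes a :: "nat \<Rightarrow> real" and p :: "int \<Rightarrow> real" and G :: "real \<Rightarrow> real"
  assumes a: "(\<lambda>x. norm (a x)) summable_on UNIV"
    and p: "(\<lambda>x. norm (p x)) summable_on UNIV"
    and Ga: "\<And>t. ((\<lambda>i. a i * cos t ^ i) has_sum G t) UNIV"
    and Gp: "\<And>t. ((\<lambda>m. of_real (p m) * cis (of_int m * t)) has_sum complex_of_real (G t)) UNIV"
  shows "((\<lambda>i. a i * cos_power_fourier i k) has_sum p k) UNIV"
proof -
  define J where "J = integral {0..2*pi} (\<lambda>t. complex_of_real (G t) * cis (- of_int k * t))"
  have "((\<lambda>m. complex_of_real (p m) * complex_of_real (if m - k = 0 then 2 * pi else 0)) has_sum J) UNIV"
    unfolding J_def
  proof (rule termwise_integral)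
    show "((\<lambda>t. cis (of_int (m - k) * t)) has_integral complex_of_real (if m - k = 0 then 2 * pi else 0)) {0..2*pi}" for m
      by (rule has_integral_cis_period)
    show "((\<lambda>m. complex_of_real (p m) * cis (of_int (m - k) * t)) has_sum
        complex_of_real (G t) * cis (- of_int k * t)) UNIV" for t
      using has_sum_cmult_left[OF Gp[of t], of "cis (- of_int k * t)"]
      by (simp add: mult.assoc cis_mult algebra_simps)
  qed (use p in \<open>auto intro!: continuous_intros\<close>)
  moreover have "((\<lambda>m. complex_of_real (p m) * complex_of_real (if m - k = 0 then 2 * pi else 0)) has_sum
      of_real (2 * pi * p k)) UNIV"
    by (rule has_sum_finite_neutralI[where B = "{k}"]) auto
  ultimately have J: "J = of_real (2 * pi * p k)" by (rule has_sum_unique)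
  have "((\<lambda>i. complex_of_real (a i) * of_real (2 * pi * cos_power_fourier i k)) has_sum J) UNIV"
    unfolding J_def
  proof (rule termwise_integral)
    show "((\<lambda>t. of_real (cos t ^ i) * cis (- of_int k * t))
        has_integral of_real (2 * pi * cos_power_fourier i k)) {0..2*pi}" for i
      by (rule has_integral_cos_power)
    show "((\<lambda>i. complex_of_real (a i) * (of_real (cos t ^ i) * cis (- of_int k * t))) has_sum
        complex_of_real (G t) * cis (- of_int k * t)) UNIV" for t
      using has_sum_cmult_left[OF has_sum_of_real[OF Ga[of t]], of "cis (- of_int k * t)"]
      by (simp add: mult.assoc)
    show "norm (of_real (cos t ^ i) * cis (- of_int k * t)) \<le> 1" for i t
      by (simp only: norm_mult norm_of_real power_abs norm_cis mult_1_right power_le_one abs_ge_zero abs_cos_le_one)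
  qed (use a in \<open>auto intro!: continuous_intros\<close>)
  hence "((\<lambda>i. complex_of_real (2 * pi * (a i * cos_power_fourier i k))) has_sum
      of_real (2 * pi * p k)) UNIV"
    by (simp add: J mult_ac)
  hence "((\<lambda>i. 2 * pi * (a i * cos_power_fourier i k)) has_sum (2 * pi * p k)) UNIV"
    by (simp only: has_sum_of_real_iff)
  from has_sum_cmult_right[OF this, of "1 / (2 * pi)"] show ?thesis by simp
qed

section \<open>The Bessel series\<close>

lemma exp_coeff_half_binomial:
  fixes k :: int and m :: nat
  assumes "0 \<le> int m + k"
  shows "half_binomial (nat (2 * int m + k)) k / fact (nat (2 * int m + k))
     = rGamma (real m + of_int k + 1) / fact m"
proof -
  define n where "n = nat (int m + k)"
  have n: "int n = int m + k" using assms by (simp add: n_def)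
  have i: "nat (2 * int m + k) = m + n" using n by linarith
  have "(int (m + n) + k) div 2 = int n" "even (int (m + n) + k)" using n by presburger+
  hence "half_binomial (m + n) k = real (m + n choose n)" by (simp add: half_binomial_def)
  also have "\<dots> = fact (m + n) / (fact n * fact m)"
    by (simp add: binomial_fact)
  finally have "half_binomial (m + n) k / fact (m + n) = 1 / (fact n * fact m)" by simp
  moreover have "real m + of_int k + 1 = 1 + real n" using n by linarith
  hence "rGamma (real m + of_int k + 1) = 1 / fact n"
    by (simp only: rGamma_inverse_Gamma Gamma_fact inverse_eq_divide)
  ultimately show ?thesis by (simp add: i)
qed

text \<open>The substitution \<open>i = 2 * m + k\<close> matches the terms with \<open>m + k \<ge> 0\<close>. Every other \<open>i\<close> has a vanishing
  Fourier coefficient, by parity or because \<open>i < \<bar>k\<bar>\<close>, and every other \<open>m\<close> has a vanishing Bessel term,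
  because \<open>rGamma\<close> is zero at the nonpositive integer \<open>m + k + 1\<close>.\<close>

lemma bessel_I_eq_cos_power_series:
  assumes "((\<lambda>i. l ^ i / fact i * cos_power_fourier i k) has_sum S) UNIV"
  shows "bessel_I k l = S"
proof -
  define g where "g = (\<lambda>i. l ^ i / fact i * cos_power_fourier i k)"
  define h where "h = (\<lambda>m. rGamma (real m + of_int k + 1) / fact m * (l / 2) powi (2 * int m + k))"
  define \<phi> where "\<phi> m = nat (2 * int m + k)" for m :: nat
  define A where "A = {m. 0 \<le> int m + k}"
  have A0: "0 \<le> 2 * int m + k" if "m \<in> A" for m using that by (auto simp: A_def)
  have inj: "inj_on \<phi> A"
    using A0 by (auto simp: inj_on_def \<phi>_def dest!: nat_eq_iff[THEN iffD1])
  have "g i = 0" if "i \<notin> \<phi> ` A" for i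
  proof (rule ccontr)
    assume "g i \<noteq> 0"
    hence *: "nat \<bar>k\<bar> \<le> i" "even (int i + k)"
      by (auto simp: g_def cos_power_fourier_def half_binomial_def split: if_splits)
    define m where "m = nat ((int i - k) div 2)"
    have "even (int i - k)" using * by simp
    hence "2 * int m = int i - k" using *(1) unfolding m_def by (auto elim!: evenE)
    hence "m \<in> A" "i = \<phi> m" using *(1) by (auto simp: A_def \<phi>_def)
    with that show False by blast
  qed
  hence "(g has_sum S) (\<phi> ` A)"
    using assms unfolding g_def[symmetric]
    by (subst has_sum_cong_neutral[where T = UNIV and g = g]) auto
  hence "((g \<circ> \<phi>) has_sum S) A" by (simp only: has_sum_reindex[OF inj])
  moreover have "g (\<phi> m) = h m" if "m \<in> A" for m
  proof -
    have m: "0 \<le> int m + k" using that by (simp add: A_def)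
    hence le: "nat \<bar>k\<bar> \<le> \<phi> m" by (auto simp: \<phi>_def)
    have "g (\<phi> m) = (l / 2) ^ \<phi> m * (half_binomial (\<phi> m) k / fact (\<phi> m))"
      using le by (simp add: g_def cos_power_fourier_def power_divide)
    also have "(l / 2) ^ \<phi> m = (l / 2) powi (2 * int m + k)"
      using A0[OF that] by (simp add: \<phi>_def power_int_def)
    finally show ?thesis
      using exp_coeff_half_binomial[OF m] by (simp add: h_def \<phi>_def)
  qed
  moreover have "h m = 0" if "m \<notin> A" for m
  proof -
    have "real m + of_int k + 1 = of_int (int m + k + 1)" by simp
    moreover have "int m + k + 1 \<le> 0" using that by (auto simp: A_def)
    ultimately have "real m + of_int k + 1 \<in> \<int>\<^sub>\<le>\<^sub>0" by (metis nonpos_Ints_of_int)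
    thus ?thesis by (simp add: h_def rGamma_eq_zero_iff)
  qed
  ultimately have "(h has_sum S) UNIV"
    by (subst has_sum_cong_neutral[where T = A and g = "g \<circ> \<phi>"]) auto
  thus ?thesis
    unfolding bessel_I_def h_def by (simp add: has_sum_imp_sums sums_unique[symmetric])
qed

section \<open>The probabilities of a symmetric discrete stable variable\<close>

lemma SDS_pgf_cis:
  "SDS_pgf \<gamma> l (cis t) = of_real (exp (- l * (1 - cos t) powr \<gamma>))"
proof -
  have "1 - (1 / 2) * (cis t + 1 / cis t) = complex_of_real (1 - cos t)"
    by (simp add: complex_eq_iff cis_divide flip: cis_zero)
  moreover have "complex_of_real (1 - cos t) powr of_real \<gamma> = of_real ((1 - cos t) powr \<gamma>)"
    by (rule powr_of_real) auto
  ultimately show ?thesis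
    unfolding SDS_pgf_def by (simp flip: exp_of_real)
qed

theorem theorem5p4:
  fixes M :: "'a measure" and X :: "'a \<Rightarrow> int" and \<gamma> l :: real
  assumes "0 < \<gamma>" and "\<gamma> \<le> 1" and "0 < l"
    and "prob_space M" and "X \<in> measurable M (count_space UNIV)"
    and "is_SDS \<gamma> l (distr M (count_space UNIV) X)"
  shows "(\<forall>k::int.
            (\<forall>i\<ge>nat \<bar>k\<bar>. summable (\<lambda>j::nat.
               (-1) ^ (i + j) * ((\<gamma> * real j) gchoose i) * (l ^ j / fact j)
                 * (1 / 2 ^ i) * half_binomial i k)) \<and>
            (\<lambda>n. let i = nat \<bar>k\<bar> + n in \<Sum>j::nat.
               (-1) ^ (i + j) * ((\<gamma> * real j) gchoose i) * (l ^ j / fact j)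
                 * (1 / 2 ^ i) * half_binomial i k)
              sums measure M {\<omega> \<in> space M. X \<omega> = k}) \<and>
         (\<gamma> = 1 \<longrightarrow> (\<forall>k::int.
            measure M {\<omega> \<in> space M. X \<omega> = k} = exp (- l) * bessel_I k l))"
proof -
  interpret prob_space M by fact
  define p where "p k = measure M {\<omega> \<in> space M. X \<omega> = k}" for k
  define G where "G t = exp (- l * (1 - cos t) powr \<gamma>)" for t
  have p_distr: "measure (distr M (count_space UNIV) X) {k} = p k" for k
    using measure_distr[OF assms(5), of "{k}"]
    by (simp add: p_def vimage_def Int_def conj_commute)
  have Gp: "((\<lambda>m. of_real (p m) * cis (of_int m * t)) has_sum complex_of_real (G t)) UNIV" for t
  proof -
    have "((\<lambda>m. of_real (p m) * cis t powi m) has_sum SDS_pgf \<gamma> l (cis t)) UNIV"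
      using assms(6) unfolding is_SDS_def p_distr by simp
    thus ?thesis by (simp add: SDS_pgf_cis G_def cis_power_int)
  qed
  have "((\<lambda>m. complex_of_real (p m)) has_sum complex_of_real (G 0)) UNIV"
    using Gp[of 0] by simp
  hence "(p has_sum G 0) UNIV" by (simp only: has_sum_of_real_iff)
  moreover have "norm (p m) = p m" for m by (simp add: p_def)
  ultimately have p: "(\<lambda>m. norm (p m)) summable_on UNIV"
    by (auto simp: summable_on_def)

  have term_sums: "(\<lambda>j. (-1) ^ (i + j) * ((\<gamma> * real j) gchoose i) * (l ^ j / fact j)
      * (1 / 2 ^ i) * half_binomial i k) sums (sds_coeff \<gamma> l i * (1 / 2 ^ i) * half_binomial i k)" for i k
    using has_sum_imp_sums[OF sds_coeff_has_sum[of \<gamma> l i]] assms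
    by (intro sums_mult2) (simp_all add: sds_term_def[abs_def])
  have series: "(\<lambda>n. let i = nat \<bar>k\<bar> + n in \<Sum>j::nat.
               (-1) ^ (i + j) * ((\<gamma> * real j) gchoose i) * (l ^ j / fact j)
                 * (1 / 2 ^ i) * half_binomial i k) sums p k" for k
  proof -
    have "((\<lambda>i. sds_coeff \<gamma> l i * cos_power_fourier i k) has_sum p k) UNIV"
    proof (rule fourier_coeff_cos_series[OF _ p _ Gp])
      show "(\<lambda>i. norm (sds_coeff \<gamma> l i)) summable_on UNIV"
        using sds_coeff_summable[of \<gamma> l] sds_coeff_nonneg[of \<gamma> l] assms by simp
      show "((\<lambda>i. sds_coeff \<gamma> l i * cos t ^ i) has_sum G t) UNIV" for t
        unfolding G_def by (rule sds_power_series_closed) (use assms in auto)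
    qed
    hence "(\<lambda>i. sds_coeff \<gamma> l i * cos_power_fourier i k) sums p k"
      by (rule has_sum_imp_sums)
    hence "(\<lambda>n. sds_coeff \<gamma> l (n + nat \<bar>k\<bar>) * cos_power_fourier (n + nat \<bar>k\<bar>) k) sums p k"
      by (subst sums_zero_iff_shift) (auto simp: cos_power_fourier_def)
    also have "(\<lambda>n. sds_coeff \<gamma> l (n + nat \<bar>k\<bar>) * cos_power_fourier (n + nat \<bar>k\<bar>) k)
        = (\<lambda>n. sds_coeff \<gamma> l (nat \<bar>k\<bar> + n) * (1 / 2 ^ (nat \<bar>k\<bar> + n)) * half_binomial (nat \<bar>k\<bar> + n) k)"
      by (simp add: cos_power_fourier_def add.commute[of _ "nat \<bar>k\<bar>"])
    finally show ?thesis
      unfolding Let_def term_sums[THEN sums_unique, symmetric] .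
  qed

  have bessel: "p k = exp (- l) * bessel_I k l" if "\<gamma> = 1" for k
  proof -
    have "((\<lambda>i. exp (- l) * (l ^ i / fact i) * cos_power_fourier i k) has_sum p k) UNIV"
    proof (rule fourier_coeff_cos_series[OF _ p _ Gp])
      have exp: "((\<lambda>i. x ^ i / fact i) has_sum exp x) UNIV" for x :: real
        using exp_converges[of x] summable_norm_exp[of x]
        by (intro norm_summable_imp_has_sum) (auto simp: divide_inverse_commute)
      show "(\<lambda>i. norm (exp (- l) * (l ^ i / fact i))) summable_on UNIV"
        using has_sum_cmult_right[OF exp[of l], of "exp (- l)"] assms
        by (auto simp: abs_mult summable_on_def)
      show "((\<lambda>i. exp (- l) * (l ^ i / fact i) * cos t ^ i) has_sum G t) UNIV" for t
      proof -
        have "G t = exp (- l) * exp (l * cos t)"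
          unfolding G_def that by (simp add: algebra_simps flip: exp_add)
        thus ?thesis
          using has_sum_cmult_right[OF exp[of "l * cos t"], of "exp (- l)"]
          by (simp add: power_mult_distrib mult_ac)
      qed
    qed
    from has_sum_cmult_right[OF this, of "exp l"]
    have "((\<lambda>i. l ^ i / fact i * cos_power_fourier i k) has_sum (exp l * p k)) UNIV"
      by (simp add: exp_minus field_simps)
    hence "bessel_I k l = exp l * p k" by (rule bessel_I_eq_cos_power_series)
    thus ?thesis by (simp add: exp_minus field_simps)
  qed
  show ?thesis
    unfolding p_def[symmetric]
    by (intro conjI allI impI series bessel sums_summable[OF term_sums])
qed

end
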